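(* $d_0(C_8)=\Gamma_t(C_8)+2$, and for every $n\geq 3$ with $n\neq 8$, $d_0(C_n)=\Gamma_t(C_n)+1$.
   Context: $C_n$ is the cycle on $n$ vertices. A total dominating set (TDS) of a graph without isolated vertices is a vertex set $S$ such that every vertex is adjacent to a vertex of $S$; a minimal TDS is a TDS no proper subset of which is a TDS; $\Gamma_t(G)$ is the maximum cardinality of a minimal TDS. For a positive integer $k$, $D_k^t(G)$ is the graph whose vertices are the TDSs of $G$ of cardinality at most $k$, two being adjacent if and only if one is obtained from the other by adding or deleting a single vertex. $d_0(G)$ is the smallest integer $\ell$ such that $D_k^t(G)$ is connected for all $k\geq\ell$. *)

theory Defs
  imports "Graph_Theory.Graph_Theory"
begin

text \<open>A simple graph is a \<^typ>\<open>'a pair_pre_digraph\<close> satisfying \<^const>\<open>pair_graph\<close>: finite,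
  loop-free and symmetric, every edge being present as a pair of opposite arcs.\<close>

definition cycle_graph :: "nat \<Rightarrow> nat pair_pre_digraph" where
  "cycle_graph n = \<lparr> pverts = {..<n},
     parcs = {(i, j). i < n \<and> j < n \<and> (j = Suc i mod n \<or> i = Suc j mod n)} \<rparr>"

definition total_dominating_set :: "'a pair_pre_digraph \<Rightarrow> 'a set \<Rightarrow> bool" where
  "total_dominating_set G S \<longleftrightarrow>
     S \<subseteq> pverts G \<and> (\<forall>v\<in>pverts G. \<exists>u\<in>S. (v, u) \<in> parcs G)"

definition minimal_tds :: "'a pair_pre_digraph \<Rightarrow> 'a set \<Rightarrow> bool" where
  "minimal_tds G S \<longleftrightarrow>
     total_dominating_set G S \<and> (\<forall>T. T \<subset> S \<longrightarrow> \<not> total_dominating_set G T)"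

text \<open>Meaningful for finite graphs without isolated vertices, which have a minimal
  total dominating set.\<close>

definition upper_total_domination_number :: "'a pair_pre_digraph \<Rightarrow> nat" where
  "upper_total_domination_number G = Max {card S |S. minimal_tds G S}"

definition tds_graph :: "'a pair_pre_digraph \<Rightarrow> nat \<Rightarrow> 'a set pair_pre_digraph" where
  "tds_graph G k =
     (let V = {S. total_dominating_set G S \<and> card S \<le> k} in
      \<lparr> pverts = V,
        parcs = {(S, T). S \<in> V \<and> T \<in> V \<and>
                   (\<exists>v. v \<notin> S \<and> T = insert v S \<or> v \<in> S \<and> T = S - {v})} \<rparr>)"

text \<open>The set under \<^const>\<open>Least\<close> is nonempty for a nonempty finite graph without isolated
  vertices, since every total dominating set can then be enlarged to the full vertex set
  once the bound is at least the number of vertices. The library's \<^const>\<open>Digraph_Component.connected\<close>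
  is false for the graph with no vertices. This convention does not affect the value on cycles:
  there the graph for bound \<^const>\<open>upper_total_domination_number\<close> has at least two vertices, one
  of which is isolated.\<close>

definition d0 :: "'a pair_pre_digraph \<Rightarrow> nat" where
  "d0 G = (LEAST l. 0 < l \<and>
     (\<forall>k\<ge>l. Digraph_Component.connected (with_proj (tds_graph G k))))"

lemma pair_graph_cycle_graph:
  assumes "n \<ge> 3"
  shows "pair_graph (cycle_graph n)"
proof -
  have fin: "finite (parcs (cycle_graph n))"
    by (rule finite_subset[of _ "{..<n} \<times> {..<n}"]) (auto simp: cycle_graph_def)
  have loop: "Suc i mod n \<noteq> i" if "i < n" for i
    using assms that by (cases "Suc i = n") auto
  show ?thesis
    by unfold_locales
      (use fin loop in \<open>auto simp: cycle_graph_def sym_def symmetric_def arcs_ends_conv dest: sym\<close>)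
qed

lemma pair_graph_tds_graph:
  assumes "finite (pverts G)"
  shows "pair_graph (tds_graph G k)"
proof -
  have V: "finite (pverts (tds_graph G k))"
    by (rule finite_subset[of _ "Pow (pverts G)"])
      (use assms in \<open>auto simp: tds_graph_def total_dominating_set_def\<close>)
  have E: "parcs (tds_graph G k) \<subseteq> pverts (tds_graph G k) \<times> pverts (tds_graph G k)"
    by (auto simp: tds_graph_def)
  have S: "sym (parcs (tds_graph G k))"
    unfolding tds_graph_def sym_def Let_def by (auto simp: insert_absorb)
  show ?thesis
  proof unfold_locales
    show "finite (parcs (tds_graph G k))"
      using V E by (meson finite_SigmaI finite_subset)
    show "symmetric (with_proj (tds_graph G k))"
      using S by (simp add: symmetric_def arcs_ends_conv)
  qed (use V E in \<open>auto simp: tds_graph_def\<close>)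
qed

end

theory Submission
  imports Defs
begin

text \<open>A set is a total dominating set of \<open>C\<^sub>n\<close> iff it meets every pair \<open>{v, v + 2}\<close>, that is, iff it is a
  vertex cover of one \<open>n\<close>-cycle (\<open>n\<close> odd) or of two disjoint cycles of length \<open>n / 2\<close> (\<open>n\<close> even). Minimal
  vertex covers of \<open>C\<^sub>m\<close> have at most \<open>G = 2 * m div 3\<close> elements, and this is attained. With the
  bound \<open>G + 1\<close>, a minimal cover missing a given vertex \<open>a\<close> can be transformed, walking once around
  the cycle, into the cover whose complement is \<open>a, a + 2, a + 4, \<dots>\<close>; hence all minimal covers missing
  a common vertex are linked, and for \<open>m \<ge> 5\<close> these classes overlap. For \<open>m \<le> 3\<close> the full vertex
  set is within the bound. For \<open>m = 4\<close> the two minimal covers are linked only through the full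
  vertex set, of size \<open>G + 2\<close>, which is the exception \<open>n = 8\<close>. When \<open>n\<close> is even the two components are
  changed one after the other, the idle one staying minimal.\<close>

section \<open>Token addition and removal\<close>

text \<open>For \<open>P\<close> the total dominating sets this is the arc relation of
  \<open>tds_graph\<close>. A general \<open>P\<close> lets paths be built among covers of short
  cycles and then carried over.\<close>

definition tar_step :: "('a set \<Rightarrow> bool) \<Rightarrow> nat \<Rightarrow> 'a set \<Rightarrow> 'a set \<Rightarrow> bool" where
  "tar_step P k S T \<longleftrightarrow> P S \<and> P T \<and> card S \<le> k \<and> card T \<le> k \<and>
     (\<exists>v. v \<notin> S \<and> T = insert v S \<or> v \<in> S \<and> T = S - {v})"

abbreviation tar_reach :: "('a set \<Rightarrow> bool) \<Rightarrow> nat \<Rightarrow> 'a set \<Rightarrow> 'a set \<Rightarrow> bool" where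
  "tar_reach P k \<equiv> (tar_step P k)\<^sup>*\<^sup>*"

definition minimal_set :: "('a set \<Rightarrow> bool) \<Rightarrow> 'a set \<Rightarrow> bool" where
  "minimal_set P S \<longleftrightarrow> P S \<and> (\<forall>T. T \<subset> S \<longrightarrow> \<not> P T)"

lemma minimal_setD:
  assumes "minimal_set P S"
  shows "P S" "T \<subset> S \<Longrightarrow> \<not> P T"
  using assms by (simp_all add: minimal_set_def)

lemma tar_step_sym: "tar_step P k S T \<Longrightarrow> tar_step P k T S"
  unfolding tar_step_def by (auto simp: insert_absorb)

lemma tar_reach_sym: "tar_reach P k S T \<Longrightarrow> tar_reach P k T S"
  by (metis sympD sympI symp_rtranclp tar_step_sym)

lemma tar_reach_mono:
  assumes "tar_reach P k S T" "k \<le> l"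
  shows "tar_reach P l S T"
  using assms(1)
proof (rule rtranclp_mono[THEN predicate2D, rotated])
  show "tar_step P k \<le> tar_step P l" using assms(2) by (auto simp: tar_step_def)
qed

text \<open>The elements of \<open>T - S\<close> are added one at a time; every intermediate set
  lies between \<open>S\<close> and \<open>T\<close>.\<close>

lemma tar_reach_superset:
  assumes "finite T" "S \<subseteq> T" "card T \<le> k" "\<And>U. S \<subseteq> U \<Longrightarrow> U \<subseteq> T \<Longrightarrow> P U"
  shows "tar_reach P k S T"
proof -
  have "tar_reach P k S (S \<union> D)" if "D \<subseteq> T - S" for D
    using finite_subset[OF that finite_Diff[OF assms(1)]] that
  proof (induction D)
    case (insert x D)
    have "card (insert x (S \<union> D)) \<le> card T" "card (S \<union> D) \<le> card T"
      using insert.prems assms(1,2) by (auto intro!: card_mono)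
    then have "tar_step P k (S \<union> D) (S \<union> insert x D)"
      unfolding tar_step_def using insert assms by (auto intro!: assms(4))
    then show ?case using insert by (meson insert_subset rtranclp.rtrancl_into_rtrancl)
  qed simp
  from this[of "T - S"] show ?thesis using assms(2) by (simp add: Un_absorb1)
qed

text \<open>The map carries single moves to single moves, while the idle part \<open>R\<close> adds
  at most \<open>r\<close> to every size. Empty \<open>R\<close> gives transport along a bijection;
  otherwise one parity class moves and the other rests.\<close>

lemma tar_reach_map:
  assumes "tar_reach P k S T"
    and "\<And>A. P A \<Longrightarrow> card A \<le> k \<Longrightarrow> Q (f ` A \<union> R) \<and> A \<subseteq> V"
    and f: "inj_on f V" "f ` V \<inter> R = {}"
    and "finite V" "finite R" "card R \<le> r"
  shows "tar_reach Q (k + r) (f ` S \<union> R) (f ` T \<union> R)"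
  using assms(1)
proof (induction rule: rtranclp_induct)
  case (step A B)
  have 1: "P A" "P B" "card A \<le> k" "card B \<le> k" using step by (auto simp: tar_step_def)
  then have sub: "A \<subseteq> V" "B \<subseteq> V" using assms(2) by auto
  have c: "card (f ` X \<union> R) \<le> k + r" if "card X \<le> k" "X \<subseteq> V" for X
    using card_Un_le[of "f ` X" R] card_image_le[of X f] that assms(5,7) finite_subset[of X V] by linarith
  obtain v where v: "v \<notin> A \<and> B = insert v A \<or> v \<in> A \<and> B = A - {v}"
    using step by (auto simp: tar_step_def)
  then have "v \<in> V" using sub by auto
  then have "f v \<notin> R" using f by auto
  have "tar_step Q (k + r) (f ` A \<union> R) (f ` B \<union> R)"
    unfolding tar_step_def
  proof (intro conjI)
    show "\<exists>w. w \<notin> f ` A \<union> R \<and> f ` B \<union> R = insert w (f ` A \<union> R) \<or>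
        w \<in> f ` A \<union> R \<and> f ` B \<union> R = f ` A \<union> R - {w}"
    proof (cases "v \<in> A")
      case True
      then have "f ` B = f ` A - {f v}"
        using v sub \<open>v \<in> V\<close> f(1) by (auto dest: inj_onD)
      then show ?thesis using True v \<open>f v \<notin> R\<close> by (intro exI[of _ "f v"]) auto
    next
      case False
      then have "f v \<notin> f ` A" using sub \<open>v \<in> V\<close> f(1) by (auto dest: inj_onD)
      then show ?thesis using False v \<open>f v \<notin> R\<close> by (intro exI[of _ "f v"]) auto
    qed
  qed (use 1 sub c assms(2) in auto)
  with step.IH show ?case by (rule rtranclp.rtrancl_into_rtrancl)
qed simp

lemma minimal_subset_exists:
  assumes "finite S" "P S"
  shows "\<exists>M\<subseteq>S. minimal_set P M"
  using assms
proof (induction S rule: finite_psubset_induct)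
  case (psubset S)
  show ?case
  proof (cases "minimal_set P S")
    case False
    then obtain T where "T \<subset> S" "P T" using psubset.prems by (auto simp: minimal_set_def)
    with psubset.IH[of T] show ?thesis by blast
  qed auto
qed

section \<open>Covers\<close>

text \<open>Vertex covers of the graph on \<open>V\<close> with edges \<open>{v, s v}\<close>. The
  successor map as a parameter treats steps of length one and of length two alike.\<close>

definition cover :: "('a \<Rightarrow> 'a) \<Rightarrow> 'a set \<Rightarrow> 'a set \<Rightarrow> bool" where
  "cover s V S \<longleftrightarrow> S \<subseteq> V \<and> (\<forall>v\<in>V. v \<in> S \<or> s v \<in> S)"

lemma cover_superset: "cover s V S \<Longrightarrow> S \<subseteq> T \<Longrightarrow> T \<subseteq> V \<Longrightarrow> cover s V T"
  by (auto simp: cover_def)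

lemma cover_image_iff:
  assumes "bij_betw f V W" "\<And>v. v \<in> V \<Longrightarrow> f (s v) = t (f v)" "\<And>v. v \<in> V \<Longrightarrow> s v \<in> V" "A \<subseteq> V"
  shows "cover t W (f ` A) \<longleftrightarrow> cover s V A"
proof -
  have inj: "f x \<in> f ` A \<longleftrightarrow> x \<in> A" if "x \<in> V" for x
    using assms(1,4) that by (auto simp: bij_betw_def dest: inj_onD)
  have W: "W = f ` V" using assms(1) by (simp add: bij_betw_def)
  show ?thesis
    unfolding cover_def W using assms(2,3,4) inj by (auto simp flip: assms(2))
qed

text \<open>Both parts are closed under \<open>s\<close>, so no edge joins them.\<close>

lemma cover_Un_iff:
  assumes "\<And>v. v \<in> V \<Longrightarrow> s v \<in> V" "\<And>v. v \<in> W \<Longrightarrow> s v \<in> W" "V \<inter> W = {}" "A \<subseteq> V" "B \<subseteq> W"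
  shows "cover s (V \<union> W) (A \<union> B) \<longleftrightarrow> cover s V A \<and> cover s W B"
proof
  assume L: "cover s (V \<union> W) (A \<union> B)"
  have "v \<in> A \<or> s v \<in> A" if "v \<in> V" for v
  proof -
    have "v \<in> A \<union> B \<or> s v \<in> A \<union> B" using L that by (auto simp: cover_def)
    then show ?thesis using that assms(1)[OF that] assms(3,5) by blast
  qed
  moreover have "v \<in> B \<or> s v \<in> B" if "v \<in> W" for v
  proof -
    have "v \<in> A \<union> B \<or> s v \<in> A \<union> B" using L that by (auto simp: cover_def)
    then show ?thesis using that assms(2)[OF that] assms(3,4) by blast
  qed
  ultimately show "cover s V A \<and> cover s W B" using assms(4,5) by (auto simp: cover_def)
qed (auto simp: cover_def)

lemma minimal_cover_image_iff:
  assumes "bij_betw f V W" "\<And>v. v \<in> V \<Longrightarrow> f (s v) = t (f v)" "\<And>v. v \<in> V \<Longrightarrow> s v \<in> V" "A \<subseteq> V"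
  shows "minimal_set (cover t W) (f ` A) \<longleftrightarrow> minimal_set (cover s V) A"
proof -
  have inj: "inj_on f V" using assms(1) by (simp add: bij_betw_def)
  have iff: "cover t W (f ` B) \<longleftrightarrow> cover s V B" if "B \<subseteq> V" for B
    using cover_image_iff[of f V W s t B] assms(1-3) that by blast
  have "(\<forall>T. T \<subset> f ` A \<longrightarrow> \<not> cover t W T) \<longleftrightarrow> (\<forall>B. B \<subset> A \<longrightarrow> \<not> cover s V B)"
  proof (intro iffI allI impI)
    fix B assume *: "\<forall>T. T \<subset> f ` A \<longrightarrow> \<not> cover t W T" "B \<subset> A"
    then have "f ` B \<subset> f ` A"
      using inj_on_subset[OF inj assms(4)] by (auto simp: psubset_eq inj_on_image_eq_iff)
    then show "\<not> cover s V B" using * iff[of B] assms(4) by auto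
  next
    fix T assume *: "\<forall>B. B \<subset> A \<longrightarrow> \<not> cover s V B" "T \<subset> f ` A"
    then obtain B where "B \<subseteq> A" "T = f ` B" by (meson psubset_imp_subset subset_imageE)
    moreover from this have "B \<noteq> A" using *(2) by auto
    ultimately show "\<not> cover t W T" using * iff[of B] assms(4) by auto
  qed
  with iff[OF assms(4)] show ?thesis by (simp add: minimal_set_def)
qed

text \<open>A proper subset of the union is proper in one of the parts; conversely, one part can
  shrink while the other stays fixed.\<close>

lemma minimal_cover_Un_iff:
  assumes "\<And>v. v \<in> V \<Longrightarrow> s v \<in> V" "\<And>v. v \<in> W \<Longrightarrow> s v \<in> W" "V \<inter> W = {}" "A \<subseteq> V" "B \<subseteq> W"
  shows "minimal_set (cover s (V \<union> W)) (A \<union> B) \<longleftrightarrow>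
    minimal_set (cover s V) A \<and> minimal_set (cover s W) B"
proof -
  have iff: "cover s (V \<union> W) (C \<union> D) \<longleftrightarrow> cover s V C \<and> cover s W D" if "C \<subseteq> V" "D \<subseteq> W" for C D
    using cover_Un_iff[of V s W C D] assms(1-3) that by blast
  show ?thesis
  proof
    assume L: "minimal_set (cover s (V \<union> W)) (A \<union> B)"
    then have c: "cover s V A" "cover s W B" using iff[OF assms(4,5)] by (auto simp: minimal_set_def)
    have "\<not> cover s V C" if "C \<subset> A" for C
    proof -
      have "C \<union> B \<subset> A \<union> B" using that assms(3,4,5) by blast
      then have "\<not> cover s (V \<union> W) (C \<union> B)" using L by (simp add: minimal_set_def)
      then show ?thesis using iff[of C B] c assms that by blast
    qed
    moreover have "\<not> cover s W D" if "D \<subset> B" for D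
    proof -
      have "A \<union> D \<subset> A \<union> B" using that assms(3,4,5) by blast
      then have "\<not> cover s (V \<union> W) (A \<union> D)" using L by (simp add: minimal_set_def)
      then show ?thesis using iff[of A D] c assms that by blast
    qed
    ultimately show "minimal_set (cover s V) A \<and> minimal_set (cover s W) B"
      using c by (simp add: minimal_set_def)
  next
    assume R: "minimal_set (cover s V) A \<and> minimal_set (cover s W) B"
    have "\<not> cover s (V \<union> W) T" if "T \<subset> A \<union> B" for T
    proof
      assume "cover s (V \<union> W) T"
      moreover have T: "T = (T \<inter> A) \<union> (T \<inter> B)" using that by blast
      ultimately have "cover s V (T \<inter> A)" "cover s W (T \<inter> B)"
        using iff[of "T \<inter> A" "T \<inter> B"] assms(4,5) by (simp_all add: le_infI2)
      then have "\<not> T \<inter> A \<subset> A" "\<not> T \<inter> B \<subset> B" using R by (auto simp: minimal_set_def)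
      then show False using that by blast
    qed
    then show "minimal_set (cover s (V \<union> W)) (A \<union> B)"
      using R iff[OF assms(4,5)] by (auto simp: minimal_set_def)
  qed
qed

text \<open>Each cover shrinks to a minimal one through covers no larger than itself, so only
  minimal covers have to be linked.\<close>

lemma tar_reach_covers:
  assumes "finite V"
    and min: "\<And>S T. minimal_set (cover s V) S \<Longrightarrow> minimal_set (cover s V) T \<Longrightarrow>
      tar_reach (cover s V) g S T"
    and "g \<le> k" "cover s V S" "card S \<le> k" "cover s V T" "card T \<le> k"
  shows "tar_reach (cover s V) k S T"
proof -
  have down: "\<exists>M. minimal_set (cover s V) M \<and> tar_reach (cover s V) k M X"
    if X: "cover s V X" "card X \<le> k" for X
  proof -
    have "X \<subseteq> V" "finite X" using X assms(1) by (auto simp: cover_def intro: finite_subset)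
    obtain M where M: "M \<subseteq> X" "minimal_set (cover s V) M"
      using minimal_subset_exists[of X "cover s V"] \<open>finite X\<close> X(1) by auto
    have "tar_reach (cover s V) k M X"
    proof (rule tar_reach_superset)
      fix U assume "M \<subseteq> U" "U \<subseteq> X"
      then show "cover s V U"
        using cover_superset[of s V M U] M(2) \<open>X \<subseteq> V\<close> by (auto simp: minimal_set_def)
    qed (use M(1) \<open>finite X\<close> X(2) in auto)
    with M show ?thesis by blast
  qed
  obtain M where M: "minimal_set (cover s V) M" "tar_reach (cover s V) k M S"
    using down[OF assms(4,5)] by blast
  obtain N where N: "minimal_set (cover s V) N" "tar_reach (cover s V) k N T"
    using down[OF assms(6,7)] by blast
  have "tar_reach (cover s V) k M N" using tar_reach_mono[OF min[OF M(1) N(1)] assms(3)] .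
  from rtranclp_trans[OF tar_reach_sym[OF M(2)] rtranclp_trans[OF this N(2)]]
  show ?thesis .
qed

section \<open>Vertex covers of a cycle\<close>

abbreviation cycle_cover :: "nat \<Rightarrow> nat set \<Rightarrow> bool" where
  "cycle_cover m \<equiv> cover (\<lambda>i. Suc i mod m) {..<m}"

text \<open>The interval is cut into blocks of three, each holding at most two elements of
  \<open>K\<close>; a final rest of at most two positions costs the \<open>+ 2\<close>.\<close>

lemma card_no_three_consecutive:
  assumes "\<And>i. i + 2 < m \<Longrightarrow> \<not> (i \<in> K \<and> i + 1 \<in> K \<and> i + 2 \<in> K)" "p \<le> m"
  shows "3 * card (K \<inter> {p..<m}) \<le> 2 * (m - p) + 2"
  using assms(2)
proof (induction "m - p" arbitrary: p rule: less_induct)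
  case less
  show ?case
  proof (cases "p + 2 < m")
    case False
    have "card (K \<inter> {p..<m}) \<le> card {p..<m}" by (intro card_mono) auto
    then show ?thesis using False less.prems by simp
  next
    case True
    have "K \<inter> {p, p+1, p+2} \<subset> {p, p+1, p+2}" using assms(1)[OF True] by blast
    then have "card (K \<inter> {p, p+1, p+2}) < card {p, p+1, p+2}" by (intro psubset_card_mono) auto
    then have "card (K \<inter> {p, p+1, p+2}) \<le> 2" by simp
    moreover have "K \<inter> {p..<m} = K \<inter> {p, p+1, p+2} \<union> K \<inter> {p+3..<m}" using True by auto
    moreover have "card (K \<inter> {p, p+1, p+2} \<union> K \<inter> {p+3..<m}) \<le>
        card (K \<inter> {p, p+1, p+2}) + card (K \<inter> {p+3..<m})"
      by (rule card_Un_le)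
    ultimately have "card (K \<inter> {p..<m}) \<le> 2 + card (K \<inter> {p+3..<m})"
      by simp
    moreover have "3 * card (K \<inter> {p+3..<m}) \<le> 2 * (m - (p+3)) + 2"
      using less.hyps[of "p+3"] True by simp
    ultimately show ?thesis using True by linarith
  qed
qed

text \<open>Walking along the cycle, the complement of \<open>K\<close> is replaced by the even numbers; the hybrid
  at stage \<open>j\<close> uses the even numbers up to \<open>2 * j\<close> and the complement of \<open>K\<close> after that.\<close>

lemma cover_reaches_odd_cover:
  assumes K: "cycle_cover m K" "0 \<notin> K" and "2 \<le> m"
    and cons: "\<And>i. i + 2 < m \<Longrightarrow> \<not> (i \<in> K \<and> i + 1 \<in> K \<and> i + 2 \<in> K)"
  shows "tar_reach (cycle_cover m) (2 * m div 3 + 1) K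
    ((\<lambda>i. 2 * i + 1) ` {..<m div 2} \<union> {2 * (m div 2)..<m})"
proof -
  define H where "H j = (\<lambda>i. 2 * i + 1) ` {..j} \<union> (K \<inter> {2*j+2..<m})" for j
  have fin: "finite (H j)" for j by (simp add: H_def)
  have Km: "K \<subseteq> {..<m}" using K(1) by (simp add: cover_def)
  have mem: "x \<in> H j \<longleftrightarrow> (if x \<le> 2*j+1 then odd x else x \<in> K)" for x j
  proof -
    have "odd x \<Longrightarrow> x \<le> 2*j+1 \<Longrightarrow> x \<in> (\<lambda>i. 2 * i + 1) ` {..j}"
      by (auto elim!: oddE)
    then show ?thesis using Km by (auto simp: H_def)
  qed
  have cov: "cycle_cover m (H j)" if "2*j+2 \<le> m" for j
    unfolding cover_def
  proof (intro conjI ballI)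
    show "H j \<subseteq> {..<m}" using that by (auto simp: H_def)
    fix v assume "v \<in> {..<m}"
    then have v: "v < m" and e: "v \<in> K \<or> Suc v mod m \<in> K" using K(1) by (auto simp: cover_def)
    consider "v < 2*j+1" | "v = 2*j+1" | "v > 2*j+1" "Suc v < m" | "v > 2*j+1" "Suc v = m"
      using v by linarith
    then show "v \<in> H j \<or> Suc v mod m \<in> H j"
    proof cases
      case 1 then show ?thesis using that by (simp add: mem)
    next
      case 2 then show ?thesis by (simp add: mem)
    next
      case 3 then show ?thesis using e by (simp add: mem)
    next
      \<comment> \<open>The successor of the last vertex is 0, which is outside \<open>K\<close>, so
        the last vertex is in \<open>K\<close>.\<close>
      case 4 then show ?thesis using e K(2) by (simp add: mem)
    qed
  qed
  have cardH: "card (H j) \<le> j + 1 + card (K \<inter> {2*j+2..<m})" for j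
  proof -
    have "card ((\<lambda>i. 2 * i + 1) ` {..j}) \<le> j + 1"
      using card_image_le[of "{..j}" "\<lambda>i. 2 * i + 1"] by simp
    then show ?thesis
      using card_Un_le[of "(\<lambda>i. 2 * i + 1) ` {..j}" "K \<inter> {2*j+2..<m}"] by (simp add: H_def)
  qed
  \<comment> \<open>The two counts give \<open>3 * card (H j) \<le> 2 * m - j + 1\<close>.\<close>
  have bound: "card (H j) \<le> 2 * m div 3 + 1" if "2*j+2 \<le> m" for j
    using cardH[of j] card_no_three_consecutive[OF cons that] that by linarith
  \<comment> \<open>With \<open>2*j+3\<close> absent, the count resumes at \<open>2*j+4\<close> and
    improves to \<open>3 * card (H j) \<le> 2 * m - j\<close>, leaving room for one more
    vertex.\<close>
  have bound': "card (H j) \<le> 2 * m div 3" if "2*j+4 \<le> m" "2*j+3 \<notin> K" for j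
  proof -
    have "K \<inter> {2*j+2..<m} \<subseteq> insert (2*j+2) (K \<inter> {2*j+4..<m})"
    proof
      fix x assume "x \<in> K \<inter> {2*j+2..<m}"
      then show "x \<in> insert (2*j+2) (K \<inter> {2*j+4..<m})"
        using that(2) by (cases "x = 2*j+2"; cases "x = 2*j+3") auto
    qed
    then have "card (K \<inter> {2*j+2..<m}) \<le> card (insert (2*j+2) (K \<inter> {2*j+4..<m}))"
      by (intro card_mono) auto
    also have "\<dots> \<le> Suc (card (K \<inter> {2*j+4..<m}))" by (simp add: card_insert_if)
    finally show ?thesis
      using cardH[of j] card_no_three_consecutive[OF cons that(1)] that by linarith
  qed
  have step: "tar_reach (cycle_cover m) (2 * m div 3 + 1) (H j) (H (Suc j))" if "2*j+4 \<le> m" for j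
  proof -
    \<comment> \<open>Passing to stage \<open>Suc j\<close> removes \<open>2*j+2\<close> if present
      and adds \<open>2*j+3\<close> if absent. Adding first keeps every intermediate set a cover,
      and the size grows only if \<open>2*j+3 \<notin> K\<close>, the case of
      \<open>bound'\<close>.\<close>
    let ?U = "H j \<union> H (Suc j)"
    have U: "?U \<subseteq> insert (2*j+3) (H j)"
    proof
      fix x assume "x \<in> ?U"
      moreover have "x = 2*j+2 \<or> x = 2*j+3 \<or> x \<le> 2*j+1 \<or> x > 2*j+3" by linarith
      ultimately show "x \<in> insert (2*j+3) (H j)" by (auto simp: mem split: if_splits)
    qed
    have c: "card ?U \<le> 2 * m div 3 + 1"
    proof (cases "2*j+3 \<in> K")
      case True
      then have "?U \<subseteq> H j" using U by (auto simp: mem)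
      then have "card ?U \<le> card (H j)" using fin by (intro card_mono) auto
      then show ?thesis using bound[of j] that by linarith
    next
      case False
      have "card ?U \<le> card (insert (2*j+3) (H j))" using U fin by (intro card_mono) auto
      also have "\<dots> \<le> Suc (card (H j))" using fin by (simp add: card_insert_if)
      finally show ?thesis using bound'[OF that False] by linarith
    qed
    have up: "tar_reach (cycle_cover m) (2 * m div 3 + 1) (H i) ?U" if i: "i \<in> {j, Suc j}" for i
    proof (rule tar_reach_superset)
      have covs: "cycle_cover m (H j)" "cycle_cover m (H (Suc j))"
        using cov[of j] cov[of "Suc j"] that \<open>2*j+4 \<le> m\<close> by simp_all
      fix W assume "H i \<subseteq> W" "W \<subseteq> ?U"
      moreover have "?U \<subseteq> {..<m}" using covs unfolding cover_def by blast
      moreover have "cycle_cover m (H i)" using covs i by blast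
      ultimately show "cycle_cover m W" by (meson cover_superset order_trans)
    next
      show "H i \<subseteq> ?U" using i by blast
      show "card ?U \<le> 2 * m div 3 + 1" by (fact c)
    qed (simp add: fin)
    have "tar_reach (cycle_cover m) (2 * m div 3 + 1) ?U (H (Suc j))"
      by (rule tar_reach_sym, rule up) simp
    from rtranclp_trans[OF up[of j] this] show ?thesis by simp
  qed
  have "tar_reach (cycle_cover m) (2 * m div 3 + 1) (H 0) (H j)" if "2*j+2 \<le> m" for j
    using that
  proof (induction j)
    case (Suc j)
    then have "tar_reach (cycle_cover m) (2 * m div 3 + 1) (H 0) (H j)" by simp
    moreover have "tar_reach (cycle_cover m) (2 * m div 3 + 1) (H j) (H (Suc j))"
      using Suc.prems by (intro step) simp
    ultimately show ?case by (rule rtranclp_trans)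
  qed simp
  from this[of "m div 2 - 1"]
  have "tar_reach (cycle_cover m) (2 * m div 3 + 1) (H 0) (H (m div 2 - 1))"
    using \<open>2 \<le> m\<close> by simp
  moreover have "H 0 = K"
  proof -
    have "0 \<in> K \<or> Suc 0 mod m \<in> K" using K(1) \<open>2 \<le> m\<close> by (auto simp: cover_def)
    then have "1 \<in> K" using K(2) \<open>2 \<le> m\<close> by simp
    then have "x \<in> H 0 \<longleftrightarrow> x \<in> K" for x
      using K(2) by (cases "x = 0"; cases "x = 1") (auto simp: mem)
    then show ?thesis by blast
  qed
  moreover have "H (m div 2 - 1) = (\<lambda>i. 2 * i + 1) ` {..<m div 2} \<union> {2 * (m div 2)..<m}"
  proof -
    have "{..m div 2 - 1} = {..<m div 2}" using \<open>2 \<le> m\<close> by auto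
    moreover have "2 * (m div 2 - 1) + 2 = 2 * (m div 2)" using \<open>2 \<le> m\<close> by auto
    \<comment> \<open>The interval is empty for even \<open>m\<close>; for odd \<open>m\<close> it
      is \<open>{m - 1}\<close>, and \<open>m - 1\<close> is in \<open>K\<close> because its
      neighbour 0 is not.\<close>
    moreover have "K \<inter> {2 * (m div 2)..<m} = {2 * (m div 2)..<m}"
    proof -
      have "m - 1 \<in> {..<m}" using \<open>2 \<le> m\<close> by auto
      then have "m - 1 \<in> K \<or> Suc (m - 1) mod m \<in> K" using K(1) unfolding cover_def by blast
      then have "m - 1 \<in> K" using K(2) \<open>2 \<le> m\<close> by simp
      moreover have "x = m - 1" if "x \<in> {2 * (m div 2)..<m}" for x
        using that by simp linarith
      ultimately show ?thesis by blast
    qed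
    ultimately show ?thesis by (simp add: H_def)
  qed
  ultimately show ?thesis by simp
qed


section \<open>Symmetries of the cycle and its minimal covers\<close>

text \<open>Serves with \<open>c = 1\<close> for rotations, and with \<open>c = 2\<close> and odd
  modulus to exchange steps of length one for steps of length two.\<close>

lemma bij_betw_affine_mod:
  fixes m :: nat
  assumes "coprime c m" "0 < m"
  shows "bij_betw (\<lambda>i. (c * i + a) mod m) {..<m} {..<m}"
proof -
  have le: "i = j" if "i \<le> j" "j < m" "(c * i + a) mod m = (c * j + a) mod m" for i j
  proof -
    have "m dvd (c * j + a) - (c * i + a)"
      using that by (subst mod_eq_dvd_iff_nat[symmetric]) (auto simp: mult_le_mono2)
    then have "m dvd c * (j - i)" by (simp add: diff_mult_distrib2)
    then have "m dvd j - i" using assms(1) by (simp add: coprime_commute coprime_dvd_mult_right_iff)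
    moreover have "j - i < m" using that(2) by simp
    ultimately have "\<not> 0 < j - i" using nat_dvd_not_less[of "j - i" m] by blast
    then show "i = j" using that(1) by simp
  qed
  have "inj_on (\<lambda>i. (c * i + a) mod m) {..<m}"
  proof (rule inj_onI)
    fix i j assume "i \<in> {..<m}" "j \<in> {..<m}" "(c * i + a) mod m = (c * j + a) mod m"
    then show "i = j" using le[of i j] le[of j i] by (cases "i \<le> j") auto
  qed
  then show ?thesis
    using endo_inj_surj[of "{..<m}" "\<lambda>i. (c * i + a) mod m"] assms(2)
    by (auto simp: bij_betw_def image_subset_iff)
qed

text \<open>\<open>a\<close> and \<open>b\<close> are nonadjacent, so no edge loses both ends. The
  case \<open>a = b\<close> removes a single vertex.\<close>

lemma cover_all_but:
  assumes "2 \<le> m" "Suc a mod m \<noteq> b" "Suc b mod m \<noteq> a"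
  shows "cycle_cover m ({..<m} - {a, b})"
proof -
  have "v \<noteq> Suc v mod m" if "v < m" for v
    using that assms(1) by (cases "Suc v = m") auto
  then show ?thesis using assms by (auto simp: cover_def)
qed

text \<open>Such a cover belongs to the class missing \<open>a\<close> and to the class missing
  \<open>b\<close>, and so links the two classes.\<close>

lemma minimal_cover_missing:
  assumes "2 \<le> m" "Suc a mod m \<noteq> b" "Suc b mod m \<noteq> a"
  obtains M where "minimal_set (cycle_cover m) M" "a \<notin> M" "b \<notin> M"
proof -
  have "\<exists>M\<subseteq>{..<m} - {a, b}. minimal_set (cycle_cover m) M"
    using cover_all_but[OF assms] by (intro minimal_subset_exists) simp_all
  then obtain M where "M \<subseteq> {..<m} - {a, b}" "minimal_set (cycle_cover m) M" by blast
  with that[of M] show ?thesis by blast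
qed

lemma minimal_cover_misses:
  assumes "minimal_set (cycle_cover m) K" "2 \<le> m"
  obtains a where "a < m" "a \<notin> K"
proof -
  have "Suc 0 mod m \<noteq> 0" using assms(2) by (subst mod_less) simp_all
  from cover_all_but[OF assms(2) this this]
  have "cycle_cover m ({..<m} - {0})" unfolding insert_absorb2 .
  moreover have "0 \<in> {..<m}" using assms(2) by simp
  ultimately have "K \<noteq> {..<m}" using minimal_setD(2)[OF assms(1), of "{..<m} - {0}"] by blast
  moreover have "K \<subseteq> {..<m}" using assms(1) by (simp add: minimal_set_def cover_def)
  ultimately obtain a where "a \<in> {..<m}" "a \<notin> K" by blast
  then show ?thesis by (simp add: that)
qed

text \<open>The middle vertex of three could be dropped. Triples running past \<open>m - 1\<close>
  contain 0; they are excluded by rotating a missing vertex to 0.\<close>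

lemma minimal_cover_no_three:
  assumes "minimal_set (cycle_cover m) K" "i + 2 < m"
  shows "\<not> (i \<in> K \<and> i + 1 \<in> K \<and> i + 2 \<in> K)"
proof
  assume K: "i \<in> K \<and> i + 1 \<in> K \<and> i + 2 \<in> K"
  have "cycle_cover m (K - {i + 1})"
    unfolding cover_def
  proof (intro conjI ballI)
    show "K - {i + 1} \<subseteq> {..<m}" using assms(1) by (auto simp: minimal_set_def cover_def)
    fix v assume v: "v \<in> {..<m}"
    then have "v \<in> K \<or> Suc v mod m \<in> K" using assms(1) by (auto simp: minimal_set_def cover_def)
    moreover have "v = i" if "Suc v mod m = i + 1"
      using that v by (cases "Suc v = m") auto
    ultimately show "v \<in> K - {i + 1} \<or> Suc v mod m \<in> K - {i + 1}"
      using K assms(2) by (cases "v = i + 1"; cases "v = i") auto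
  qed
  moreover have "K - {i + 1} \<subset> K" using K by blast
  ultimately show False using minimal_setD(2)[OF assms(1), of "K - {i + 1}"] by blast
qed

text \<open>The missing vertex becomes 0, the starting point of the walk and of the linear count.
  The factor \<open>1\<close> makes the rotation an instance of
  \<open>bij_betw_affine_mod\<close>.\<close>

lemma minimal_cover_rotate:
  assumes "minimal_set (cycle_cover m) K" "2 \<le> m" "a < m" "a \<notin> K"
  obtains L where "minimal_set (cycle_cover m) L" "0 \<notin> L" "K = (\<lambda>i. (1 * i + a) mod m) ` L"
proof -
  define f where "f = (\<lambda>i. (1 * i + a) mod m)"
  have bij: "bij_betw f {..<m} {..<m}"
    unfolding f_def using assms(2) by (intro bij_betw_affine_mod) auto
  define L where "L = {i\<in>{..<m}. f i \<in> K}"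
  have "K \<subseteq> f ` {..<m}" using assms(1) bij by (auto simp: minimal_set_def cover_def bij_betw_def)
  then have K: "K = f ` L" by (auto simp: L_def)
  have "minimal_set (cycle_cover m) (f ` L) \<longleftrightarrow> minimal_set (cycle_cover m) L"
    using bij by (rule minimal_cover_image_iff) (use assms(2) in \<open>auto simp: f_def L_def mod_simps\<close>)
  moreover have "0 \<notin> L" using assms(3,4) by (simp add: L_def f_def)
  ultimately show ?thesis using that[of L] assms(1) K unfolding f_def by simp
qed

text \<open>After rotation only the \<open>m - 1\<close> positions from 1 on can be occupied, so the
  count gives \<open>3 * card L \<le> 2 * (m - 1) + 2 = 2 * m\<close>.\<close>

lemma card_minimal_cover_le:
  assumes "minimal_set (cycle_cover m) K" "2 \<le> m"
  shows "card K \<le> 2 * m div 3"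
proof -
  obtain a where "a < m" "a \<notin> K" using minimal_cover_misses[OF assms] .
  then obtain L where L: "minimal_set (cycle_cover m) L" "0 \<notin> L" "K = (\<lambda>i. (1 * i + a) mod m) ` L"
    using minimal_cover_rotate[OF assms] by blast
  have "L \<subseteq> {..<m}" using L(1) by (auto simp: minimal_set_def cover_def)
  moreover have "x \<in> {1..<m}" if "x \<in> L" for x
    using that L(2) calculation by (cases x) auto
  ultimately have "L \<inter> {1..<m} = L" "finite L" by (auto intro: finite_subset)
  moreover have "3 * card (L \<inter> {1..<m}) \<le> 2 * (m - 1) + 2"
    using minimal_cover_no_three[OF L(1)] assms(2) by (intro card_no_three_consecutive) auto
  moreover have "card K \<le> card L" unfolding L(3) using \<open>finite L\<close> by (rule card_image_le)
  ultimately show ?thesis using assms(2) by simp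
qed

text \<open>Both covers walk to the same rotated odd cover, which depends only on \<open>m\<close>
  and \<open>a\<close>.\<close>

lemma tar_reach_common_missing:
  assumes "minimal_set (cycle_cover m) K" "a \<notin> K" "minimal_set (cycle_cover m) K'" "a \<notin> K'"
    and "2 \<le> m" "a < m"
  shows "tar_reach (cycle_cover m) (2 * m div 3 + 1) K K'"
proof -
  define f where "f = (\<lambda>i. (1 * i + a) mod m)"
  have bij: "bij_betw f {..<m} {..<m}"
    unfolding f_def using assms(5) by (intro bij_betw_affine_mod) auto
  define J where "J = (\<lambda>i. 2 * i + 1) ` {..<m div 2} \<union> {2 * (m div 2)..<m}"
  have "tar_reach (cycle_cover m) (2 * m div 3 + 1) X (f ` J)"
    if X: "minimal_set (cycle_cover m) X" "a \<notin> X" for X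
  proof -
    obtain L where L: "minimal_set (cycle_cover m) L" "0 \<notin> L" "X = f ` L"
      using minimal_cover_rotate[OF X(1) assms(5,6) X(2)] unfolding f_def by blast
    have "tar_reach (cycle_cover m) (2 * m div 3 + 1) L J"
      unfolding J_def using L assms(5) minimal_cover_no_three[OF L(1)]
      by (intro cover_reaches_odd_cover) (auto simp: minimal_set_def)
    then have "tar_reach (cycle_cover m) (2 * m div 3 + 1 + 0) (f ` L \<union> {}) (f ` J \<union> {})"
    proof (rule tar_reach_map)
      fix A assume "cycle_cover m A"
      moreover from this have A: "A \<subseteq> {..<m}" by (simp add: cover_def)
      moreover have "cycle_cover m (f ` A) \<longleftrightarrow> cycle_cover m A"
        using bij by (rule cover_image_iff) (use A assms(5) in \<open>auto simp: f_def mod_simps\<close>)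
      ultimately show "cycle_cover m (f ` A \<union> {}) \<and> A \<subseteq> {..<m}" by simp
    qed (use bij in \<open>auto simp: bij_betw_def\<close>)
    then show ?thesis using L(3) by simp
  qed
  from rtranclp_trans[OF this[OF assms(1,2)] tar_reach_sym[OF this[OF assms(3,4)]]]
  show ?thesis .
qed

text \<open>Consecutive vertices \<open>d\<close>, \<open>d + 1\<close> are both nonadjacent to \<open>d + 3\<close>, which links the covers
  missing \<open>d\<close> to those missing \<open>d + 1\<close>. This needs at least five vertices.\<close>

lemma tar_reach_minimal_covers:
  assumes "5 \<le> m" "minimal_set (cycle_cover m) K" "minimal_set (cycle_cover m) K'"
  shows "tar_reach (cycle_cover m) (2 * m div 3 + 1) K K'"
proof -
  have m: "2 \<le> m" using assms(1) by simp
  have red: "x mod m = (if x < m then x else x - m)" if "x < 2 * m" for x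
    using that by (simp add: mod_if)
  \<comment> \<open>The index \<open>d\<close> runs over all naturals and is reduced modulo
    \<open>m\<close>, so that the induction moves from class to class around the cycle.\<close>
  have from0: "tar_reach (cycle_cover m) (2 * m div 3 + 1) X Y"
    if "minimal_set (cycle_cover m) X" "0 \<notin> X" "minimal_set (cycle_cover m) Y" "d mod m \<notin> Y" for X Y d
    using that(3,4)
  proof (induction d arbitrary: Y)
    case 0
    then show ?case using tar_reach_common_missing[OF that(1,2) 0(1) _ m] m by simp
  next
    case (Suc d)
    define a where "a = d mod m"
    have a: "a < m" "Suc d mod m = Suc a mod m" using m by (auto simp: a_def mod_Suc_eq)
    define b c where "b = Suc a mod m" and "c = (a + 3) mod m"
    have bc: "b < m" "c < m" using m by (auto simp: b_def c_def)
    \<comment> \<open>On four vertices \<open>a + 3\<close> would be adjacent to \<open>a\<close>;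
      from five on it is adjacent to neither \<open>a\<close> nor \<open>b\<close>.\<close>
    have ac: "Suc a mod m \<noteq> c" "Suc c mod m \<noteq> a" "Suc b mod m \<noteq> c" "Suc c mod m \<noteq> b"
      using a(1) bc assms(1) by (auto simp: b_def c_def red split: if_splits)
    obtain M where M: "minimal_set (cycle_cover m) M" "a \<notin> M" "c \<notin> M"
      using minimal_cover_missing[OF m ac(1,2)] .
    obtain N where N: "minimal_set (cycle_cover m) N" "b \<notin> N" "c \<notin> N"
      using minimal_cover_missing[OF m ac(3,4)] .
    have "tar_reach (cycle_cover m) (2 * m div 3 + 1) X M" using Suc.IH M by (simp add: a_def)
    also have "tar_reach (cycle_cover m) (2 * m div 3 + 1) M N"
      by (rule tar_reach_common_missing[OF M(1,3) N(1,3) m bc(2)])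
    also have "tar_reach (cycle_cover m) (2 * m div 3 + 1) N Y"
      using tar_reach_common_missing[OF N(1,2) Suc.prems(1) _ m bc(1)] Suc.prems(2) a(2) by (simp add: b_def)
    finally show ?case .
  qed
  obtain N where N: "minimal_set (cycle_cover m) N" "0 \<notin> N"
    using minimal_cover_missing[OF m, of 0 0] m by auto
  obtain a where a: "a < m" "a \<notin> K" using minimal_cover_misses[OF assms(2) m] .
  obtain a' where a': "a' < m" "a' \<notin> K'" using minimal_cover_misses[OF assms(3) m] .
  have "tar_reach (cycle_cover m) (2 * m div 3 + 1) K N"
    using from0[OF N assms(2), of a] a tar_reach_sym by simp
  also have "tar_reach (cycle_cover m) (2 * m div 3 + 1) N K'"
    using from0[OF N assms(3), of a'] a' by simp
  finally show ?thesis .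
qed

lemma tar_reach_through_all:
  assumes "cover s V S" "cover s V T" "finite V" "card V \<le> k"
  shows "tar_reach (cover s V) k S T"
proof -
  have "tar_reach (cover s V) k X V" if "cover s V X" for X
    using that assms(3,4) by (intro tar_reach_superset) (auto simp: cover_def)
  from rtranclp_trans[OF this[OF assms(1)] tar_reach_sym[OF this[OF assms(2)]]]
  show ?thesis .
qed

lemma tar_reach_minimal_covers':
  assumes "2 \<le> m" "m \<noteq> 4" "minimal_set (cycle_cover m) K" "minimal_set (cycle_cover m) K'"
  shows "tar_reach (cycle_cover m) (2 * m div 3 + 1) K K'"
proof (cases "5 \<le> m")
  case True
  then show ?thesis using tar_reach_minimal_covers assms by blast
next
  case False
  then have "m = 2 \<or> m = 3" using assms(1,2) by linarith
  \<comment> \<open>For both values \<open>2 * m div 3 + 1 = m\<close>, so the full vertex set is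
    within the bound.\<close>
  then show ?thesis
    using assms(3,4) by (intro tar_reach_through_all) (auto simp: minimal_set_def)
qed

section \<open>A minimal cover of the largest size\<close>

text \<open>Each \<open>v\<close> in \<open>K\<close> has an edge whose other end is outside
  \<open>K\<close>, so a cover inside \<open>K\<close> has to keep \<open>v\<close>.\<close>

lemma minimal_coverI:
  assumes "cycle_cover m K"
    and "\<And>v. v \<in> K \<Longrightarrow> Suc v mod m \<notin> K \<or> (\<exists>u<m. u \<notin> K \<and> Suc u mod m = v)"
  shows "minimal_set (cycle_cover m) K"
  unfolding minimal_set_def
proof (intro conjI allI impI notI)
  fix T assume T: "T \<subset> K" "cycle_cover m T"
  then obtain v where v: "v \<in> K" "v \<notin> T" by blast
  then have "v < m" using assms(1) by (auto simp: cover_def)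
  have T': "u \<in> T \<or> Suc u mod m \<in> T" if "u < m" for u using T(2) that by (simp add: cover_def)
  from assms(2)[OF v(1)] show False
    using T'[OF \<open>v < m\<close>] T' T(1) v(2) by blast
qed (rule assms(1))

lemma card_not_1_mod_3: "card {i. i < p \<and> i mod 3 \<noteq> (1::nat)} = (2 * p + 1) div 3"
proof (induction p)
  case (Suc p)
  have "{i. i < Suc p \<and> i mod 3 \<noteq> 1} =
      (if p mod 3 = 1 then {i. i < p \<and> i mod 3 \<noteq> 1} else insert p {i. i < p \<and> i mod 3 \<noteq> 1})"
    by (auto simp: less_Suc_eq)
  then have "card {i. i < Suc p \<and> i mod 3 \<noteq> 1} = (if p mod 3 = 1 then (2 * p + 1) div 3 else (2 * p + 1) div 3 + 1)"
    using Suc by simp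
  also have "\<dots> = (2 * Suc p + 1) div 3" by presburger
  finally show ?case .
qed simp

text \<open>Omitting 1, 4, 7, ... leaves pairs between single omitted vertices, the densest pattern
  without three in a row.\<close>

lemma large_minimal_cover:
  assumes "2 \<le> m"
  obtains K where "minimal_set (cycle_cover m) K" "card K = 2 * m div 3"
proof -
  \<comment> \<open>If 3 does not divide \<open>m\<close>, the vertex \<open>m - 1\<close> is
    omitted too: for \<open>m = 3 * q + 1\<close> it would otherwise be the middle of the three
    chosen vertices \<open>m - 2\<close>, \<open>m - 1\<close>, 0.\<close>
  define p where "p = (if 3 dvd m then m else m - 1)"
  define K where "K = {i. i < p \<and> i mod 3 \<noteq> 1}"
  obtain q where "m = 3 * q \<or> m = 3 * q + 1 \<or> m = 3 * q + 2"
  proof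
    have "m = 3 * (m div 3) + m mod 3" "m mod 3 < 3" by simp_all
    then show "m = 3 * (m div 3) \<or> m = 3 * (m div 3) + 1 \<or> m = 3 * (m div 3) + 2" by linarith
  qed
  then have "3 dvd m \<and> m = 3 * q \<and> p = 3 * q \<or> \<not> 3 dvd m \<and> m = 3 * q + 1 \<and> p = 3 * q \<or>
      \<not> 3 dvd m \<and> m = 3 * q + 2 \<and> p = 3 * q + 1"
    unfolding p_def by (auto simp: dvd_eq_mod_eq_0)
  then have "p mod 3 \<noteq> 2 \<and> 0 < p \<and> (p = m \<or> Suc p = m \<and> \<not> 3 dvd m) \<and> (p = m \<longrightarrow> 3 dvd m) \<and>
      p \<le> m \<and> (2 * p + 1) div 3 = 2 * m div 3"
    using assms by (elim disjE conjE; simp; presburger)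
  \<comment> \<open>The first fact says that \<open>p - 1\<close> is chosen, so that the cut at
    \<open>p\<close> leaves no two adjacent vertices omitted.\<close>
  then have p: "p mod 3 \<noteq> 2" "0 < p" "p = m \<or> Suc p = m \<and> \<not> 3 dvd m"
    "p = m \<Longrightarrow> 3 dvd m" and pm: "p \<le> m" "(2 * p + 1) div 3 = 2 * m div 3"
    by blast+
  have "minimal_set (cycle_cover m) K"
  proof (rule minimal_coverI)
    show "cycle_cover m K"
      unfolding cover_def
    proof (intro conjI ballI)
      show "K \<subseteq> {..<m}" using pm by (auto simp: K_def)
      fix v assume "v \<in> {..<m}"
      then have "v < p \<or> Suc v = m \<and> p < m" using p(3) by auto
      then consider "v < p" "v mod 3 \<noteq> 1" | "v < p" "v mod 3 = 1" | "Suc v = m" "p < m" by blast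
      then show "v \<in> K \<or> Suc v mod m \<in> K"
      proof cases
        case 2
        then have "Suc v mod 3 = 2" by (simp add: mod_Suc)
        moreover from this have "Suc v \<noteq> p" using p(1) by auto
        ultimately have "Suc v < p" "Suc v mod 3 = 2" using 2 by simp_all
        then show ?thesis using 2 pm by (simp add: K_def)
      qed (use p in \<open>auto simp: K_def\<close>)
    qed
    fix v assume "v \<in> K"
    then have v: "v < p" "v mod 3 = 0 \<or> v mod 3 = 2" by (auto simp: K_def)
    \<comment> \<open>A vertex of residue 2 has an omitted predecessor, one of residue 0 an omitted
      successor.\<close>
    then show "Suc v mod m \<notin> K \<or> (\<exists>u<m. u \<notin> K \<and> Suc u mod m = v)"
    proof (cases "v mod 3 = 2")
      case True
      then have *: "Suc (v - 1) = v" by (cases v) auto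
      then have "Suc (v - 1) mod 3 = 2" using True by simp
      then have "(v - 1) mod 3 = 1" by (simp add: mod_Suc split: if_splits)
      then show ?thesis using * v pm by (intro disjI2 exI[of _ "v - 1"]) (auto simp: K_def)
    next
      case False
      then have *: "Suc v mod 3 = 1" using v(2) by (simp add: mod_Suc)
      then have "Suc v \<noteq> m \<or> p \<noteq> m" using p(4) by (auto simp: dvd_eq_mod_eq_0)
      then have "Suc v < m" using v(1) pm(1) by linarith
      then show ?thesis using * by (simp add: K_def)
    qed
  qed
  moreover have "card K = 2 * m div 3" using card_not_1_mod_3[of p] pm by (simp add: K_def)
  ultimately show ?thesis using that by blast
qed

section \<open>Total dominating sets of cycles\<close>

text \<open>The neighbours of \<open>v + 1\<close> are \<open>v\<close> and \<open>v + 2\<close>, so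
  dominating \<open>v + 1\<close> means covering the edge \<open>{v, v + 2}\<close>.\<close>

lemma total_dominating_set_cycle:
  assumes "3 \<le> n"
  shows "total_dominating_set (cycle_graph n) = cover (\<lambda>v. (v + 2) mod n) {..<n}"
proof (intro ext iffI)
  fix S
  assume S: "total_dominating_set (cycle_graph n) S"
  have "v \<in> S \<or> (v + 2) mod n \<in> S" if v: "v < n" for v
  proof -
    have lt: "Suc v mod n < n" using assms by simp
    obtain u where u: "u \<in> S" "u < n" "u = Suc (Suc v mod n) mod n \<or> Suc v mod n = Suc u mod n"
      using S lt by (auto simp: total_dominating_set_def cycle_graph_def)
    have "v = u" if "Suc v mod n = Suc u mod n"
      using that v u(2) assms by (cases "Suc v = n"; cases "Suc u = n") auto
    then show ?thesis using u by (auto simp: mod_Suc_eq)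
  qed
  then show "cover (\<lambda>v. (v + 2) mod n) {..<n} S"
    using S by (auto simp: total_dominating_set_def cycle_graph_def cover_def)
next
  fix S
  assume S: "cover (\<lambda>v. (v + 2) mod n) {..<n} S"
  have "\<exists>u\<in>S. u < n \<and> (u = Suc v mod n \<or> v = Suc u mod n)" if v: "v < n" for v
  proof -
    obtain w where w: "w < n" "v = Suc w mod n"
    proof (cases v)
      case 0
      then show ?thesis using that[of "n - 1"] assms by simp
    next
      case (Suc w)
      then show ?thesis using that[of w] v by simp
    qed
    then have "w \<in> S \<or> (w + 2) mod n \<in> S" using S by (auto simp: cover_def)
    then show ?thesis
    proof
      assume "w \<in> S"
      with w show ?thesis by blast
    next
      assume "(w + 2) mod n \<in> S"
      moreover have "(w + 2) mod n = Suc v mod n" by (simp add: w(2) mod_Suc_eq)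
      ultimately show ?thesis using assms by (intro bexI[of _ "(w + 2) mod n"]) auto
    qed
  qed
  then show "total_dominating_set (cycle_graph n) S"
    using S by (auto simp: total_dominating_set_def cycle_graph_def cover_def)
qed

lemma minimal_tds_eq: "minimal_tds G = minimal_set (total_dominating_set G)"
  by (rule ext) (simp add: minimal_tds_def minimal_set_def)

text \<open>Doubling is a bijection modulo odd \<open>n\<close> and turns steps of length one into
  steps of length two, so the facts on \<open>cycle_cover n\<close> carry over.\<close>

lemma odd_cycle_tds:
  assumes "odd n" "3 \<le> n"
  shows "\<exists>S. minimal_set (cover (\<lambda>v. (v + 2) mod n) {..<n}) S \<and> card S = 2 * n div 3"
    and "minimal_set (cover (\<lambda>v. (v + 2) mod n) {..<n}) S \<Longrightarrow>
      minimal_set (cover (\<lambda>v. (v + 2) mod n) {..<n}) T \<Longrightarrow>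
      tar_reach (cover (\<lambda>v. (v + 2) mod n) {..<n}) (2 * n div 3 + 1) S T"
proof -
  let ?P = "cover (\<lambda>v. (v + 2) mod n) {..<n}"
  define f where "f = (\<lambda>i. (2 * i + 0) mod n)"
  have "coprime 2 n" using assms(1) by simp
  then have bij: "bij_betw f {..<n} {..<n}"
    unfolding f_def using assms(2) by (intro bij_betw_affine_mod) auto
  have comm: "f (Suc v mod n) = (f v + 2) mod n" for v by (simp add: f_def mod_simps)
  have n: "Suc v mod n \<in> {..<n}" for v using assms(2) by simp
  have cov: "?P (f ` A) \<longleftrightarrow> cycle_cover n A" if "A \<subseteq> {..<n}" for A
    using bij comm n that by (rule cover_image_iff)
  have min: "minimal_set ?P (f ` A) \<longleftrightarrow> minimal_set (cycle_cover n) A" if "A \<subseteq> {..<n}" for A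
    using bij comm n that by (rule minimal_cover_image_iff)
  obtain K where K: "minimal_set (cycle_cover n) K" "card K = 2 * n div 3"
    using large_minimal_cover[of n] assms(2) by auto
  then have "K \<subseteq> {..<n}" by (auto simp: minimal_set_def cover_def)
  moreover from this have "card (f ` K) = card K"
    using bij by (auto simp: bij_betw_def intro: card_image inj_on_subset)
  ultimately show "\<exists>S. minimal_set ?P S \<and> card S = 2 * n div 3" using K min by metis
  assume S: "minimal_set ?P S" and T: "minimal_set ?P T"
  have pre: "\<exists>A\<subseteq>{..<n}. X = f ` A" if "minimal_set ?P X" for X
  proof -
    have "X \<subseteq> f ` {..<n}" using that bij by (auto simp: minimal_set_def cover_def bij_betw_def)
    then show ?thesis by (meson subset_imageE)
  qed
  obtain A B where AB: "A \<subseteq> {..<n}" "S = f ` A" "B \<subseteq> {..<n}" "T = f ` B"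
    using pre[OF S] pre[OF T] by blast
  then have "tar_reach (cycle_cover n) (2 * n div 3 + 1) A B"
    using S T min assms by (intro tar_reach_minimal_covers') auto
  then have "tar_reach ?P (2 * n div 3 + 1 + 0) (f ` A \<union> {}) (f ` B \<union> {})"
  proof (rule tar_reach_map)
    fix X assume "cycle_cover n X"
    moreover from this have "X \<subseteq> {..<n}" by (simp add: cover_def)
    ultimately show "?P (f ` X \<union> {}) \<and> X \<subseteq> {..<n}" using cov by simp
  qed (use bij in \<open>auto simp: bij_betw_def\<close>)
  then show "tar_reach ?P (2 * n div 3 + 1) S T" using AB by simp
qed

text \<open>Steps of length two preserve parity, so that a total dominating set of an even cycle is a
  pair of vertex covers of the cycle of half the length.\<close>

lemma even_cycle_tds:
  fixes m :: nat
  assumes "2 \<le> m"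
  defines "P \<equiv> cover (\<lambda>v. (v + 2) mod (2 * m)) {..<2 * m}"
  shows "\<exists>S. minimal_set P S \<and> card S = 2 * (2 * m div 3)"
    and "minimal_set P S \<Longrightarrow> card S \<le> 2 * (2 * m div 3)"
    and "(\<And>A B. minimal_set (cycle_cover m) A \<Longrightarrow> minimal_set (cycle_cover m) B \<Longrightarrow>
        tar_reach (cycle_cover m) (2 * m div 3 + e) A B) \<Longrightarrow>
      minimal_set P S \<Longrightarrow> minimal_set P T \<Longrightarrow> tar_reach P (2 * (2 * m div 3) + e) S T"
proof -
  let ?s = "\<lambda>v. (v + 2) mod (2 * m)"
  \<comment> \<open>\<open>f\<close> and \<open>g\<close> place the \<open>m\<close>-cycle on the
    even and on the odd vertices.\<close>
  define f g where "f = (\<lambda>i::nat. 2 * i)" and "g = (\<lambda>i::nat. 2 * i + 1)"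
  define V W where "V = f ` {..<m}" and "W = g ` {..<m}"
  have f: "bij_betw f {..<m} V" and g: "bij_betw g {..<m} W"
    unfolding V_def W_def by (simp_all add: bij_betw_def inj_on_def f_def g_def)
  have fs: "f (Suc i mod m) = ?s (f i)" and gs: "g (Suc i mod m) = ?s (g i)" if i: "i \<in> {..<m}" for i
  proof -
    consider "Suc i < m" | "Suc i = m" using i by fastforce
    then have "f (Suc i mod m) = ?s (f i) \<and> g (Suc i mod m) = ?s (g i)"
    proof cases
      case 1
      then have "2 * i + 2 < 2 * m" "2 * i + 1 + 2 < 2 * m" by simp_all
      with 1 show ?thesis by (simp only: f_def g_def mod_less) simp
    next
      case 2
      then have "2 * i + 2 = 2 * m" "2 * i + 1 + 2 = 1 + 2 * m" by simp_all
      moreover have "1 < 2 * m" using assms(1) by simp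
      ultimately show ?thesis
        unfolding f_def g_def 2 mod_self by (simp only: mod_add_self2 mod_self mod_less) simp
    qed
    then show "f (Suc i mod m) = ?s (f i)" "g (Suc i mod m) = ?s (g i)" by simp_all
  qed
  have sm: "Suc i mod m \<in> {..<m}" for i using assms(1) by simp
  have "x \<in> V \<union> W" if "x < 2 * m" for x
  proof (cases "even x")
    case True
    then show ?thesis using that by (auto simp: V_def f_def elim!: evenE)
  next
    case False
    then show ?thesis using that by (auto simp: W_def g_def elim!: oddE)
  qed
  then have VW: "{..<2 * m} = V \<union> W" by (auto simp: V_def W_def f_def g_def)
  have dis: "V \<inter> W = {}" by (auto simp: V_def W_def f_def g_def) presburger
  have Vs: "?s v \<in> V" if v: "v \<in> V" for v
  proof -
    obtain i where i: "i \<in> {..<m}" "v = f i" using v by (auto simp: V_def)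
    show ?thesis unfolding i(2) fs[OF i(1), symmetric] V_def using sm by (rule imageI)
  qed
  have Ws: "?s v \<in> W" if v: "v \<in> W" for v
  proof -
    obtain i where i: "i \<in> {..<m}" "v = g i" using v by (auto simp: W_def)
    show ?thesis unfolding i(2) gs[OF i(1), symmetric] W_def using sm by (rule imageI)
  qed
  have sub: "f ` A \<subseteq> V" "g ` A \<subseteq> W" if "A \<subseteq> {..<m}" for A
    using that by (auto simp: V_def W_def)
  have cov: "P (f ` A \<union> g ` B) \<longleftrightarrow> cycle_cover m A \<and> cycle_cover m B"
    if A: "A \<subseteq> {..<m}" and B: "B \<subseteq> {..<m}" for A B
  proof -
    have "cover ?s (V \<union> W) (f ` A \<union> g ` B) \<longleftrightarrow> cover ?s V (f ` A) \<and> cover ?s W (g ` B)"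
      using Vs Ws dis sub(1)[OF A] sub(2)[OF B] by (rule cover_Un_iff)
    moreover have "cover ?s V (f ` A) \<longleftrightarrow> cycle_cover m A"
      using f fs sm A by (rule cover_image_iff)
    moreover have "cover ?s W (g ` B) \<longleftrightarrow> cycle_cover m B"
      using g gs sm B by (rule cover_image_iff)
    ultimately show ?thesis by (simp only: P_def VW)
  qed
  have min: "minimal_set P (f ` A \<union> g ` B) \<longleftrightarrow>
      minimal_set (cycle_cover m) A \<and> minimal_set (cycle_cover m) B"
    if A: "A \<subseteq> {..<m}" and B: "B \<subseteq> {..<m}" for A B
  proof -
    have "minimal_set (cover ?s (V \<union> W)) (f ` A \<union> g ` B) \<longleftrightarrow>
        minimal_set (cover ?s V) (f ` A) \<and> minimal_set (cover ?s W) (g ` B)"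
      using Vs Ws dis sub(1)[OF A] sub(2)[OF B] by (rule minimal_cover_Un_iff)
    moreover have "minimal_set (cover ?s V) (f ` A) \<longleftrightarrow> minimal_set (cycle_cover m) A"
      using f fs sm A by (rule minimal_cover_image_iff)
    moreover have "minimal_set (cover ?s W) (g ` B) \<longleftrightarrow> minimal_set (cycle_cover m) B"
      using g gs sm B by (rule minimal_cover_image_iff)
    ultimately show ?thesis by (simp only: P_def VW)
  qed
  have msub: "A \<subseteq> {..<m}" if "minimal_set (cycle_cover m) A" for A
    using that by (auto simp: minimal_set_def cover_def)
  have card: "card (f ` A \<union> g ` B) = card A + card B" if "A \<subseteq> {..<m}" "B \<subseteq> {..<m}" for A B
  proof -
    have "finite A" "finite B" using that by (auto intro: finite_subset)
    moreover have "f ` A \<inter> g ` B = {}" using sub[OF that(1)] sub[OF that(2)] dis by blast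
    moreover have "card (f ` A) = card A" "card (g ` B) = card B"
      by (auto intro!: card_image simp: inj_on_def f_def g_def)
    ultimately show ?thesis by (simp add: card_Un_disjoint)
  qed
  have split: "\<exists>A B. X = f ` A \<union> g ` B \<and> minimal_set (cycle_cover m) A \<and> minimal_set (cycle_cover m) B"
    if X: "minimal_set P X" for X
  proof -
    have "X \<subseteq> V \<union> W" using X by (simp add: P_def VW minimal_set_def cover_def)
    then have "X = f ` {i\<in>{..<m}. f i \<in> X} \<union> g ` {i\<in>{..<m}. g i \<in> X}"
      unfolding V_def W_def by blast
    moreover from this have "minimal_set (cycle_cover m) {i\<in>{..<m}. f i \<in> X} \<and>
        minimal_set (cycle_cover m) {i\<in>{..<m}. g i \<in> X}"
      using X by (subst min[symmetric]) auto
    ultimately show ?thesis by blast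
  qed
  obtain K where K: "minimal_set (cycle_cover m) K" "card K = 2 * m div 3"
    using large_minimal_cover[OF assms(1)] .
  have "minimal_set P (f ` K \<union> g ` K)" using min[OF msub msub] K by simp
  moreover have "card (f ` K \<union> g ` K) = 2 * (2 * m div 3)" using card[OF msub msub] K by simp
  ultimately show "\<exists>S. minimal_set P S \<and> card S = 2 * (2 * m div 3)" by blast
  show "card S \<le> 2 * (2 * m div 3)" if S: "minimal_set P S"
  proof -
    obtain A B where AB: "S = f ` A \<union> g ` B" "minimal_set (cycle_cover m) A" "minimal_set (cycle_cover m) B"
      using split[OF S] by blast
    then show ?thesis
      using card_minimal_cover_le[OF AB(2) assms(1)] card_minimal_cover_le[OF AB(3) assms(1)]
      by (simp add: card msub)
  qed
  \<comment> \<open>\<open>e\<close> is the slack granted to the moving component: 1 for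
    \<open>m \<noteq> 4\<close>, 2 for \<open>m = 4\<close>.\<close>
  assume reach: "\<And>A B. minimal_set (cycle_cover m) A \<Longrightarrow> minimal_set (cycle_cover m) B \<Longrightarrow>
        tar_reach (cycle_cover m) (2 * m div 3 + e) A B"
    and S: "minimal_set P S" and T: "minimal_set P T"
  obtain A B where AB: "S = f ` A \<union> g ` B" "minimal_set (cycle_cover m) A" "minimal_set (cycle_cover m) B"
    using split[OF S] by blast
  obtain C D where CD: "T = f ` C \<union> g ` D" "minimal_set (cycle_cover m) C" "minimal_set (cycle_cover m) D"
    using split[OF T] by blast
  have fin: "finite X" if "minimal_set (cycle_cover m) X" for X
    using msub[OF that] by (auto intro: finite_subset)
  have small: "card (h ` X) \<le> 2 * m div 3" if "minimal_set (cycle_cover m) X" for h :: "nat \<Rightarrow> nat" and X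
    using card_image_le[OF fin[OF that], of h] card_minimal_cover_le[OF that assms(1)] by simp
  \<comment> \<open>First the even part moves from \<open>A\<close> to \<open>C\<close> while
    \<open>B\<close> rests, then the odd part from \<open>B\<close> to \<open>D\<close> while
    \<open>C\<close> rests. The resting part is minimal, hence has at most
    \<open>2 * m div 3\<close> vertices.\<close>
  have "tar_reach P (2 * m div 3 + e + 2 * m div 3) (f ` A \<union> g ` B) (f ` C \<union> g ` B)"
    using reach[OF AB(2) CD(2)]
  proof (rule tar_reach_map)
    fix X assume X: "cycle_cover m X"
    then have "X \<subseteq> {..<m}" by (simp add: cover_def)
    moreover have "cycle_cover m B" using AB(3) by (simp add: minimal_set_def)
    ultimately show "P (f ` X \<union> g ` B) \<and> X \<subseteq> {..<m}" using cov[of X B] msub[OF AB(3)] X by simp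
  qed (use f dis sub(2)[OF msub[OF AB(3)]] small[OF AB(3)] fin[OF AB(3)] in
      \<open>auto simp: bij_betw_def V_def\<close>)
  moreover have "tar_reach P (2 * m div 3 + e + 2 * m div 3) (g ` B \<union> f ` C) (g ` D \<union> f ` C)"
    using reach[OF AB(3) CD(3)]
  proof (rule tar_reach_map)
    fix X assume X: "cycle_cover m X"
    then have "X \<subseteq> {..<m}" by (simp add: cover_def)
    moreover have "cycle_cover m C" using CD(2) by (simp add: minimal_set_def)
    ultimately show "P (g ` X \<union> f ` C) \<and> X \<subseteq> {..<m}"
      using cov[of C X] msub[OF CD(2)] X by (simp add: Un_commute)
  qed (use g dis sub(1)[OF msub[OF CD(2)]] small[OF CD(2)] fin[OF CD(2)] in
      \<open>auto simp: bij_betw_def W_def\<close>)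
  ultimately have "tar_reach P (2 * m div 3 + e + 2 * m div 3) S T"
    unfolding AB(1) CD(1) by (simp add: Un_commute)
  then show "tar_reach P (2 * (2 * m div 3) + e) S T" by (simp add: mult_2 ac_simps)
qed

section \<open>The reconfiguration graph\<close>

text \<open>Connectedness in the library is strong connectedness of the symmetrized digraph and
  includes being nonempty; the arcs here are symmetric already, so reachability is
  \<open>tar_reach\<close>.\<close>

lemma connected_tds_graph_iff:
  "Digraph_Component.connected (with_proj (tds_graph G k)) \<longleftrightarrow>
    (\<exists>S. total_dominating_set G S \<and> card S \<le> k) \<and>
    (\<forall>S T. total_dominating_set G S \<longrightarrow> card S \<le> k \<longrightarrow> total_dominating_set G T \<longrightarrow> card T \<le> k \<longrightarrow>
      tar_reach (total_dominating_set G) k S T)"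
proof -
  let ?P = "total_dominating_set G"
  define H where "H = with_proj (mk_symmetric (with_proj (tds_graph G k)))"
  have V: "verts H = {S. ?P S \<and> card S \<le> k}"
    by (simp add: H_def mk_symmetric_def tds_graph_def Let_def)
  have arcs: "(S, T) \<in> arcs_ends H \<longleftrightarrow> tar_step ?P k S T" for S T
  proof -
    have "(S, T) \<in> arcs_ends H \<longleftrightarrow> tar_step ?P k S T \<or> tar_step ?P k T S"
      by (auto simp: H_def mk_symmetric_def tds_graph_def Let_def arcs_ends_conv tar_step_def)
    then show ?thesis using tar_step_sym by blast
  qed
  have "S \<rightarrow>\<^sup>*\<^bsub>H\<^esub> T \<longleftrightarrow> tar_reach ?P k S T" if "S \<in> verts H" for S T
  proof
    assume "S \<rightarrow>\<^sup>*\<^bsub>H\<^esub> T"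
    then show "tar_reach ?P k S T"
      unfolding reachable_def
    proof (induction rule: rtrancl_on.induct)
      case (rtrancl_on_into_rtrancl_on a b c)
      then show ?case using arcs by (meson rtranclp.rtrancl_into_rtrancl)
    qed simp
  next
    assume "tar_reach ?P k S T"
    then show "S \<rightarrow>\<^sup>*\<^bsub>H\<^esub> T"
      unfolding reachable_def
    proof (induction rule: rtranclp_induct)
      case (step Y Z)
      then have "Z \<in> verts H" by (simp add: V tar_step_def)
      then show ?case using step arcs by (meson rtrancl_on_into_rtrancl_on)
    qed (use that in simp)
  qed
  then show ?thesis
    unfolding Digraph_Component.connected_def strongly_connected_def H_def[symmetric]
    using V by auto
qed

section \<open>Locating \<open>d0\<close> from the last disconnected bound\<close>

lemma d0_eqI:
  assumes "\<not> Digraph_Component.connected (with_proj (tds_graph G g))"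
    and "\<And>k. g < k \<Longrightarrow> Digraph_Component.connected (with_proj (tds_graph G k))"
  shows "d0 G = g + 1"
  unfolding d0_def
proof (rule Least_equality)
  fix l assume "0 < l \<and> (\<forall>k\<ge>l. Digraph_Component.connected (with_proj (tds_graph G k)))"
  then show "g + 1 \<le> l" using assms(1) by (metis Suc_eq_plus1 not_less_eq_eq)
qed (use assms(2) in auto)

text \<open>The full vertex set contains a minimal total dominating set, so the finite set under
  \<open>Max\<close> is nonempty.\<close>

lemma
  assumes "finite (pverts G)" "total_dominating_set G (pverts G)"
  shows card_minimal_tds_le: "minimal_tds G S \<Longrightarrow> card S \<le> upper_total_domination_number G"
    and upper_total_domination_number_attained:
      "\<exists>S. minimal_tds G S \<and> card S = upper_total_domination_number G"
proof -
  have "{S. minimal_tds G S} \<subseteq> Pow (pverts G)"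
    by (auto simp: minimal_tds_def total_dominating_set_def)
  then have fin: "finite {card S |S. minimal_tds G S}"
    using assms(1) by (simp add: setcompr_eq_image finite_subset)
  then show "minimal_tds G S \<Longrightarrow> card S \<le> upper_total_domination_number G"
    unfolding upper_total_domination_number_def by (auto intro: Max_ge)
  have "{card S |S. minimal_tds G S} \<noteq> {}"
    using minimal_subset_exists[of "pverts G" "total_dominating_set G"] assms
    by (auto simp: minimal_tds_eq)
  from Max_in[OF fin this] show "\<exists>S. minimal_tds G S \<and> card S = upper_total_domination_number G"
    unfolding upper_total_domination_number_def by auto
qed

lemma cycle_all_tds:
  assumes "3 \<le> n"
  shows "finite (pverts (cycle_graph n))" "total_dominating_set (cycle_graph n) (pverts (cycle_graph n))"
proof -
  have V: "pverts (cycle_graph n) = {..<n}" by (simp add: cycle_graph_def)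
  show "finite (pverts (cycle_graph n))" by (simp add: V)
  show "total_dominating_set (cycle_graph n) (pverts (cycle_graph n))"
    unfolding V total_dominating_set_cycle[OF assms] by (simp add: cover_def)
qed

text \<open>A largest minimal total dominating set is isolated.\<close>

lemma cycle_not_connected_upper:
  assumes "3 \<le> n"
  shows "\<not> Digraph_Component.connected
    (with_proj (tds_graph (cycle_graph n) (upper_total_domination_number (cycle_graph n))))"
proof
  let ?G = "cycle_graph n"
  let ?g = "upper_total_domination_number ?G" and ?P = "total_dominating_set ?G"
  assume con: "Digraph_Component.connected (with_proj (tds_graph ?G ?g))"
  obtain S where S: "minimal_tds ?G S" "card S = ?g"
    using upper_total_domination_number_attained[OF cycle_all_tds[OF assms]] by blast
  have PS: "?P S" using S by (simp add: minimal_tds_def)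
  have Sn: "S \<subseteq> {..<n}" "0 \<in> S \<or> (0 + 2) mod n \<in> S"
    using PS assms unfolding total_dominating_set_cycle[OF assms] cover_def by auto
  then obtain x where x: "x \<in> S" "x < n" by auto
  have "x \<noteq> (x + 2) mod n"
  proof (cases "x + 2 < n")
    case False
    then have "(x + 2) mod n = x + 2 - n" using x(2) assms by (simp add: le_mod_geq)
    then show ?thesis using False assms by simp
  qed simp
  \<comment> \<open>Dropping \<open>x \<in> S\<close> alone from the full set leaves a cover; a
    minimal one inside it is a second vertex of the graph, different from \<open>S\<close>.\<close>
  then have "?P ({..<n} - {x})"
    using assms unfolding total_dominating_set_cycle[OF assms] cover_def by auto
  then have "\<exists>T\<subseteq>{..<n} - {x}. minimal_set ?P T" by (intro minimal_subset_exists) simp_all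
  then obtain T where T: "T \<subseteq> {..<n} - {x}" "minimal_tds ?G T" unfolding minimal_tds_eq by blast
  have PT: "?P T" "card T \<le> ?g"
    using T(2) card_minimal_tds_le[OF cycle_all_tds[OF assms]] by (auto simp: minimal_tds_def)
  have "tar_reach ?P ?g S T"
    using con PS PT S(2) unfolding connected_tds_graph_iff by simp
  then show False
  proof (cases rule: converse_rtranclpE)
    case base
    then show ?thesis using x(1) T(1) by blast
  next
    case (step U)
    then obtain v where v: "v \<notin> S \<and> U = insert v S \<or> v \<in> S \<and> U = S - {v}"
      and U: "?P U" "card U \<le> ?g" by (auto simp: tar_step_def)
    \<comment> \<open>Adding a vertex to \<open>S\<close> exceeds the bound, and removing one
      contradicts minimality.\<close>
    from v show ?thesis
    proof
      assume "v \<notin> S \<and> U = insert v S"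
      then show ?thesis using U(2) S(2) finite_subset[OF Sn(1)] by simp
    next
      assume "v \<in> S \<and> U = S - {v}"
      then have "U \<subset> S" by blast
      then show ?thesis using S(1) U(1) by (simp add: minimal_tds_def)
    qed
  qed
qed

text \<open>The bound on \<open>upper_total_domination_number\<close> supplies a vertex of the
  graph; \<open>tar_reach_covers\<close> extends the paths between minimal covers to all covers of
  size at most \<open>k\<close>.\<close>

lemma cycle_connected:
  assumes "3 \<le> n" and k: "upper_total_domination_number (cycle_graph n) \<le> k" "h \<le> k"
    and reach: "\<And>S T. minimal_set (cover (\<lambda>v. (v + 2) mod n) {..<n}) S \<Longrightarrow>
      minimal_set (cover (\<lambda>v. (v + 2) mod n) {..<n}) T \<Longrightarrow>
      tar_reach (cover (\<lambda>v. (v + 2) mod n) {..<n}) h S T"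
  shows "Digraph_Component.connected (with_proj (tds_graph (cycle_graph n) k))"
proof -
  obtain S where S: "minimal_tds (cycle_graph n) S" "card S \<le> k"
    using upper_total_domination_number_attained[OF cycle_all_tds[OF assms(1)]] k by auto
  then have "total_dominating_set (cycle_graph n) S" by (simp add: minimal_tds_def)
  moreover have "tar_reach (total_dominating_set (cycle_graph n)) k A B"
    if "total_dominating_set (cycle_graph n) A" "card A \<le> k"
      "total_dominating_set (cycle_graph n) B" "card B \<le> k" for A B
    using tar_reach_covers[OF finite_lessThan reach k(2)] that
    unfolding total_dominating_set_cycle[OF assms(1)] by blast
  ultimately show ?thesis unfolding connected_tds_graph_iff using S(2) by blast
qed

text \<open>Some minimal cover has size \<open>h\<close>, and all minimal covers are linked within
  \<open>h + 1\<close>. As \<open>h\<close> is at most \<open>upper_total_domination_number\<close>,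
  every larger bound admits these paths.\<close>

lemma d0_cycle_eq:
  assumes "3 \<le> n" "n \<noteq> 8"
  shows "d0 (cycle_graph n) = upper_total_domination_number (cycle_graph n) + 1"
proof -
  let ?P = "cover (\<lambda>v. (v + 2) mod n) {..<n}"
  have "\<exists>h. (\<exists>S. minimal_set ?P S \<and> card S = h) \<and>
      (\<forall>S T. minimal_set ?P S \<longrightarrow> minimal_set ?P T \<longrightarrow> tar_reach ?P (h + 1) S T)"
  proof (cases "odd n")
    case True
    then show ?thesis using odd_cycle_tds[OF True assms(1)] by blast
  next
    case False
    then obtain m where m: "n = 2 * m" by auto
    then have "2 \<le> m" "m \<noteq> 4" using assms by auto
    then show ?thesis
      unfolding m using even_cycle_tds(1)[of m] even_cycle_tds(3)[of m 1] tar_reach_minimal_covers'[of m]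
      by blast
  qed
  then obtain h S where S: "minimal_set ?P S" "card S = h"
    and reach: "\<And>S T. minimal_set ?P S \<Longrightarrow> minimal_set ?P T \<Longrightarrow> tar_reach ?P (h + 1) S T" by blast
  have "h \<le> upper_total_domination_number (cycle_graph n)"
    using card_minimal_tds_le[OF cycle_all_tds[OF assms(1)], of S] S
    by (simp add: minimal_tds_eq total_dominating_set_cycle[OF assms(1)])
  then show ?thesis
    using cycle_connected[OF assms(1) _ _ reach] cycle_not_connected_upper[OF assms(1)]
    by (intro d0_eqI) auto
qed

text \<open>Among total dominating sets of size at most five, containing \<open>{0, 4}\<close> is invariant: leaving
  this class requires \<open>{0, 2, 4, 6}\<close> and at least two odd vertices.\<close>

lemma cycle_8_not_connected: "\<not> Digraph_Component.connected (with_proj (tds_graph (cycle_graph 8) 5))"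
proof
  let ?P = "total_dominating_set (cycle_graph 8)"
  assume con: "Digraph_Component.connected (with_proj (tds_graph (cycle_graph 8) 5))"
  have P: "?P X \<longleftrightarrow> X \<subseteq> {..<8} \<and> (\<forall>v<8. v \<in> X \<or> (v + 2) mod 8 \<in> X)" for X
    by (auto simp: total_dominating_set_cycle cover_def)
  have edge: "x \<in> X \<or> y \<in> X" if "?P X" "x < 8" "(x + 2) mod 8 = y" for X x y
    using that unfolding P by blast
  have all8: "(\<forall>v<8. Q v) \<longleftrightarrow> Q 0 \<and> Q 1 \<and> Q 2 \<and> Q 3 \<and> Q 4 \<and> Q 5 \<and> Q 6 \<and> Q (7::nat)" for Q
    by (simp add: numeral_eq_Suc All_less_Suc2)
  \<comment> \<open>Both have four elements and agree on the odd vertices; on the even ones they are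
    the two minimal covers of a 4-cycle.\<close>
  have "?P {0, 4, 1, 5}" "?P {2, 6, 1, 5}" unfolding P all8 by simp_all
  then have "tar_reach ?P 5 {0, 4, 1, 5} {2, 6, 1, 5}"
    using con unfolding connected_tds_graph_iff by simp
  then have "{0, 4} \<subseteq> {2, 6, 1, 5 :: nat}"
  proof (induction rule: rtranclp_induct)
    case (step X Y)
    have PX: "?P X" and PY: "?P Y" and c: "card X \<le> 5" using step.hyps(2) by (auto simp: tar_step_def)
    obtain v where v: "Y = insert v X \<or> Y = X - {v}" using step.hyps(2) by (auto simp: tar_step_def)
    show ?case
    proof (rule ccontr)
      assume "\<not> {0, 4} \<subseteq> Y"
      then have "0 \<notin> Y \<or> 4 \<notin> Y" "Y \<subseteq> X" using v step.IH by auto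
      \<comment> \<open>The lost vertex, 0 or 4, is joined to both 2 and 6 by steps of length
        two.\<close>
      then have "2 \<in> Y" "6 \<in> Y"
        using edge[OF PY, of 0 2] edge[OF PY, of 2 4] edge[OF PY, of 4 6] edge[OF PY, of 6 0] by auto
      then have "{0, 2, 4, 6} \<subseteq> X" using \<open>Y \<subseteq> X\<close> step.IH by auto
      \<comment> \<open>The edges \<open>{1, 3}\<close> and \<open>{5, 7}\<close> are disjoint, so
        two odd vertices join the four even ones: six in all.\<close>
      moreover obtain a b where "a \<in> X" "a = 1 \<or> a = 3" "b \<in> X" "b = 5 \<or> b = 7"
        using edge[OF PX, of 1 3] edge[OF PX, of 5 7] by auto
      moreover have "finite X" using PX unfolding P by (auto intro: finite_subset)
      ultimately have "card {0, 2, 4, 6, a, b} \<le> card X" by (intro card_mono) auto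
      moreover have "card {0, 2, 4, 6, a, b} = 6"
        using \<open>a = 1 \<or> a = 3\<close> \<open>b = 5 \<or> b = 7\<close> by auto
      ultimately show False using c by simp
    qed
  qed simp
  then show False by simp
qed

theorem theorem3p9:
  shows "d0 (cycle_graph 8) = upper_total_domination_number (cycle_graph 8) + 2
    \<and> (\<forall>n. n \<ge> 3 \<and> n \<noteq> 8 \<longrightarrow>
          d0 (cycle_graph n) = upper_total_domination_number (cycle_graph n) + 1)"
proof -
  \<comment> \<open>The form \<open>2 * 4\<close> matches the statements of
    \<open>even_cycle_tds\<close> for \<open>m = 4\<close>.\<close>
  let ?P = "cover (\<lambda>v. (v + 2) mod (2 * 4)) {..<2 * 4 :: nat}"
  let ?g = "upper_total_domination_number (cycle_graph 8)"
  have P: "total_dominating_set (cycle_graph 8) = ?P" by (simp add: total_dominating_set_cycle)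
  obtain S where S: "minimal_tds (cycle_graph 8) S" "card S = ?g"
    using upper_total_domination_number_attained[OF cycle_all_tds[of 8]] by auto
  have "?g \<le> 4" using even_cycle_tds(2)[of 4 S] S by (simp add: minimal_tds_eq P)
  moreover obtain T where T: "minimal_set ?P T" "card T = 4" using even_cycle_tds(1)[of 4] by auto
  then have "4 \<le> ?g"
    using card_minimal_tds_le[OF cycle_all_tds[of 8], of T] by (simp add: minimal_tds_eq P)
  ultimately have g: "?g = 4" by simp
  \<comment> \<open>\<open>2 * 4 div 3 + 2 = 4\<close> admits the full vertex set of a
    4-cycle.\<close>
  have reach4: "tar_reach (cycle_cover 4) (2 * 4 div 3 + 2) K L"
    if "minimal_set (cycle_cover 4) K" "minimal_set (cycle_cover 4) L" for K L
    using that by (intro tar_reach_through_all) (auto simp: minimal_set_def)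
  \<comment> \<open>This bound equals 6, the first \<open>k\<close> beyond 5.\<close>
  have "tar_reach ?P (2 * (2 * 4 div 3) + 2) A B" if "minimal_set ?P A" "minimal_set ?P B" for A B
    using reach4 that by (intro even_cycle_tds(3)) simp_all
  then have "Digraph_Component.connected (with_proj (tds_graph (cycle_graph 8) k))" if "5 < k" for k
    using that g by (intro cycle_connected[of 8 k 6]) auto
  then have "d0 (cycle_graph 8) = 5 + 1" using cycle_8_not_connected by (intro d0_eqI)
  with g show ?thesis using d0_cycle_eq by auto
qed

end
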